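(* Let $\widetilde a$ be a unitary transition amplitude on $\mathcal P$ with coupling constants $c_{n,j}^k$, and let $U_n\colon H_n\to H_{n+1}$, $n\ge 1$, be the linear operator determined by $U_n\widehat x_{n,j}=\sum_{k=0}^3 c_{n,j}^k\,\widehat x_{n+1,4j+k}$ for $j=0,1,\ldots,4^{n-1}-1$. Then for every $n\ge 1$: (i) The adjoint $U_n^*\colon H_{n+1}\to H_n$ is given by $$U_n^*\widehat x_{n+1,4j+k}=\overline{c_{n,j}^k}\,\widehat x_{n,j},\qquad k=0,1,2,3,\quad j=0,1,\ldots,4^{n-1}-1.$$ (ii) $U_n$ is a partial isometry with $U_n^*U_n=I_n$ (the identity operator on $H_n$) and $$U_nU_n^*=\sum_{j=0}^{4^{n-1}-1}\Bigl|\sum_{k=0}^3c_{n,j}^k\widehat x_{n+1,4j+k}\Bigr\rangle\Bigl\langle\sum_{k=0}^3c_{n,j}^k\widehat x_{n+1,4j+k}\Bigr| .$$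
   Context: For $n=1,2,\ldots$ let $\mathcal P_n=\{x_{n,0},x_{n,1},\ldots,x_{n,4^{n-1}-1}\}$ be a set of $4^{n-1}$ distinct elements, the $\mathcal P_n$ being pairwise disjoint, and let $\mathcal P=\bigcup_n\mathcal P_n$. (In the source, $\mathcal P_n$ is the set of covariant finite posets of cardinality $2n-1$, suitably ordered; only the tree structure matters here.) Write $x\to y$ ("$y$ is an offspring of $x$") if and only if $x=x_{n,j}$ and $y=x_{n+1,4j+k}$ for some $n\ge1$, $0\le j\le 4^{n-1}-1$, $k\in\{0,1,2,3\}$. Thus each $x\in\mathcal P$ has exactly four offspring and each $x\ne x_{1,0}$ is the offspring of a unique element. A unitary transition amplitude is a map $\widetilde a\colon\mathcal P\times\mathcal P\to\mathbb C$ with $\widetilde a(x,y)=0$ if $x\not\to y$, and $\sum_{y\in\mathcal P}\widetilde a(x,y)=1$ and $\sum_{y\in\mathcal P}|\widetilde a(x,y)|^2=1$ for every $x\in\mathcal P$. Its coupling constants are $c_{n,j}^k=\widetilde a(x_{n,j},x_{n+1,4j+k})$, $k=0,1,2,3$; hence $\sum_{k=0}^3c_{n,j}^k=\sum_{k=0}^3|c_{n,j}^k|^2=1$. $H_n$ is the Hilbert space of all functions $f\colon\mathcal P_n\to\mathbb C$ with inner product $\langle f,g\rangle=\sum_{x\in\mathcal P_n}\overline{f(x)}g(x)$ (conjugate-linear in the first variable), and $\widehat x_{n,j}\in H_n$ is the characteristic function of $\{x_{n,j}\}$; these form an orthonormal basis of $H_n$. $|v\rangle\langle w|$ denotes the operator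 $u\mapsto\langle w,u\rangle v$. *)

theory Defs
  imports "HOL-Analysis.Analysis" "HOL-Library.Function_Algebras"
begin

text \<open>An enumeration \<open>x\<close> names the vertices; \<open>x n j\<close> is meaningful only for \<open>n \<ge> 1\<close> and
  \<open>j < 4 ^ (n - 1)\<close>.\<close>

definition level :: "(nat \<Rightarrow> nat \<Rightarrow> 'a) \<Rightarrow> nat \<Rightarrow> 'a set" where
  "level x n = x n ` {..<4 ^ (n - 1)}"

definition vertices :: "(nat \<Rightarrow> nat \<Rightarrow> 'a) \<Rightarrow> 'a set" where
  "vertices x = (\<Union>n\<in>{1..}. level x n)"

definition tree_enumeration :: "(nat \<Rightarrow> nat \<Rightarrow> 'a) \<Rightarrow> bool" where
  "tree_enumeration x \<longleftrightarrow>
     (\<forall>n\<ge>1. inj_on (x n) {..<4 ^ (n - 1)}) \<and> disjoint_family_on (level x) {1..}"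

definition offspring :: "(nat \<Rightarrow> nat \<Rightarrow> 'a) \<Rightarrow> 'a \<Rightarrow> 'a \<Rightarrow> bool" where
  "offspring x p q \<longleftrightarrow>
     (\<exists>n\<ge>1. \<exists>j<4 ^ (n - 1). \<exists>k<4. p = x n j \<and> q = x (n + 1) (4 * j + k))"

definition unitary_transition_amplitude ::
    "(nat \<Rightarrow> nat \<Rightarrow> 'a) \<Rightarrow> ('a \<Rightarrow> 'a \<Rightarrow> complex) \<Rightarrow> bool" where
  "unitary_transition_amplitude x a \<longleftrightarrow>
     (\<forall>p\<in>vertices x. \<forall>q\<in>vertices x. \<not> offspring x p q \<longrightarrow> a p q = 0) \<and>
     (\<forall>p\<in>vertices x. ((\<lambda>q. a p q) has_sum 1) (vertices x)) \<and>
     (\<forall>p\<in>vertices x. ((\<lambda>q. (cmod (a p q))\<^sup>2) has_sum 1) (vertices x))"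

definition coupling ::
    "(nat \<Rightarrow> nat \<Rightarrow> 'a) \<Rightarrow> ('a \<Rightarrow> 'a \<Rightarrow> complex) \<Rightarrow> nat \<Rightarrow> nat \<Rightarrow> nat \<Rightarrow> complex" where
  "coupling x a n j k = a (x n j) (x (n + 1) (4 * j + k))"

text \<open>A function from \<open>A\<close> to the complex numbers is represented by its extension by zero to the
  whole type. Operators are total HOL functions of which only the values on \<open>fun_space A\<close> matter.
  Addition, zero and finite sums of functions (and of operators) are pointwise.\<close>

definition fun_space :: "'a set \<Rightarrow> ('a \<Rightarrow> complex) set" where
  "fun_space A = {f. \<forall>y. y \<notin> A \<longrightarrow> f y = 0}"

definition cscale :: "complex \<Rightarrow> ('a \<Rightarrow> complex) \<Rightarrow> 'a \<Rightarrow> complex" (infixr "*\<^sub>C" 75) where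
  "c *\<^sub>C f = (\<lambda>y. c * f y)"

definition ip :: "'a set \<Rightarrow> ('a \<Rightarrow> complex) \<Rightarrow> ('a \<Rightarrow> complex) \<Rightarrow> complex" where
  "ip A f g = (\<Sum>y\<in>A. cnj (f y) * g y)"

definition ip_norm :: "'a set \<Rightarrow> ('a \<Rightarrow> complex) \<Rightarrow> real" where
  "ip_norm A f = sqrt (Re (ip A f f))"

definition hat :: "'a \<Rightarrow> 'a \<Rightarrow> complex" where
  "hat p = indicator {p}"

definition ketbra ::
    "'a set \<Rightarrow> ('a \<Rightarrow> complex) \<Rightarrow> ('a \<Rightarrow> complex) \<Rightarrow> ('a \<Rightarrow> complex) \<Rightarrow> 'a \<Rightarrow> complex" where
  "ketbra A v w = (\<lambda>u. ip A w u *\<^sub>C v)"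

definition linear_op ::
    "'a set \<Rightarrow> 'b set \<Rightarrow> (('a \<Rightarrow> complex) \<Rightarrow> ('b \<Rightarrow> complex)) \<Rightarrow> bool" where
  "linear_op A B T \<longleftrightarrow>
     (\<forall>f\<in>fun_space A. T f \<in> fun_space B) \<and>
     (\<forall>f\<in>fun_space A. \<forall>g\<in>fun_space A. T (f + g) = T f + T g) \<and>
     (\<forall>c. \<forall>f\<in>fun_space A. T (c *\<^sub>C f) = c *\<^sub>C T f)"

text \<open>For finite \<open>A\<close>, \<open>B\<close> and linear \<open>T\<close> the description is uniquely satisfiable;
  see \<open>adjoint_op_ip\<close>, \<open>adjoint_op_unique\<close> and \<open>linear_op_adjoint_op\<close> below.\<close>

definition adjoint_op ::
    "'a set \<Rightarrow> 'b set \<Rightarrow> (('a \<Rightarrow> complex) \<Rightarrow> ('b \<Rightarrow> complex)) \<Rightarrow> ('b \<Rightarrow> complex) \<Rightarrow> ('a \<Rightarrow> complex)"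
  where
  "adjoint_op A B T g =
     (THE f. f \<in> fun_space A \<and> (\<forall>h\<in>fun_space A. ip A f h = ip B g (T h)))"

text \<open>A partial isometry is isometric on the orthogonal complement of its kernel.\<close>

definition partial_isometry ::
    "'a set \<Rightarrow> 'b set \<Rightarrow> (('a \<Rightarrow> complex) \<Rightarrow> ('b \<Rightarrow> complex)) \<Rightarrow> bool" where
  "partial_isometry A B T \<longleftrightarrow> linear_op A B T \<and>
     (\<forall>f\<in>fun_space A.
        (\<forall>h\<in>fun_space A. T h = 0 \<longrightarrow> ip A h f = 0) \<longrightarrow> ip_norm B (T f) = ip_norm A f)"

lemma hat_in_fun_space: "p \<in> A \<Longrightarrow> hat p \<in> fun_space A"
  by (auto simp: hat_def fun_space_def indicator_def)

lemma fun_space_add: "f \<in> fun_space A \<Longrightarrow> g \<in> fun_space A \<Longrightarrow> f + g \<in> fun_space A"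
  by (simp add: fun_space_def)

lemma fun_space_cscale: "f \<in> fun_space A \<Longrightarrow> c *\<^sub>C f \<in> fun_space A"
  by (simp add: fun_space_def cscale_def)

lemma fun_space_0: "0 \<in> fun_space A"
  by (simp add: fun_space_def)

lemma fun_space_sum: "(\<And>i. i \<in> I \<Longrightarrow> f i \<in> fun_space A) \<Longrightarrow> sum f I \<in> fun_space A"
  by (induction I rule: infinite_finite_induct) (auto simp: fun_space_0 fun_space_add)

lemma sum_fun_apply: "(\<Sum>i\<in>I. f i) y = (\<Sum>i\<in>I. f i y)"
  by (induction I rule: infinite_finite_induct) auto

lemma ip_hat_left: "finite A \<Longrightarrow> p \<in> A \<Longrightarrow> ip A (hat p) f = f p"
  by (simp add: ip_def hat_def indicator_def if_distrib sum.If_cases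
      flip: of_bool_def) (simp add: of_bool_def if_distrib if_distribR cong: if_cong)

lemma ip_hat_right: "finite A \<Longrightarrow> p \<in> A \<Longrightarrow> ip A f (hat p) = cnj (f p)"
  by (simp add: ip_def hat_def indicator_def of_bool_def if_distrib cong: if_cong)

lemma fun_space_expand:
  assumes "finite A" "f \<in> fun_space A"
  shows "f = (\<Sum>p\<in>A. f p *\<^sub>C hat p)"
proof
  fix y
  show "f y = (\<Sum>p\<in>A. f p *\<^sub>C hat p) y"
    using assms
    by (auto simp: sum_fun_apply cscale_def hat_def indicator_def of_bool_def fun_space_def
        if_distrib cong: if_cong)
qed

lemma linear_op_0: "linear_op A B T \<Longrightarrow> T 0 = 0"
  unfolding linear_op_def using fun_space_0 by (metis add_cancel_right_right)

lemma linear_op_sum: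
  assumes "linear_op A B T" "\<And>i. i \<in> I \<Longrightarrow> f i \<in> fun_space A"
  shows "T (sum f I) = (\<Sum>i\<in>I. T (f i))"
  using assms(2)
proof (induction I rule: infinite_finite_induct)
  case (insert i I)
  then have "T (f i + sum f I) = T (f i) + T (sum f I)"
    using assms(1) fun_space_sum[of I f A] by (simp add: linear_op_def)
  with insert show ?case by (simp only: sum.insert insertI2 if_True simp_thms insert_iff)
qed (use assms(1) linear_op_0 in auto)

lemma linear_op_expand:
  assumes "finite A" "linear_op A B T" "f \<in> fun_space A"
  shows "T f = (\<Sum>p\<in>A. f p *\<^sub>C T (hat p))"
proof -
  have "T f = T (\<Sum>p\<in>A. f p *\<^sub>C hat p)"
    using fun_space_expand[OF assms(1,3)] by simp
  also have "\<dots> = (\<Sum>p\<in>A. T (f p *\<^sub>C hat p))"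
    by (rule linear_op_sum[OF assms(2)]) (simp add: fun_space_cscale hat_in_fun_space)
  also have "\<dots> = (\<Sum>p\<in>A. f p *\<^sub>C T (hat p))"
    using assms(2) by (intro sum.cong) (auto simp: linear_op_def hat_in_fun_space)
  finally show ?thesis .
qed

lemma linear_op_eqI:
  assumes "finite A" "linear_op A B S" "linear_op A B T"
    and "\<And>p. p \<in> A \<Longrightarrow> S (hat p) = T (hat p)" "f \<in> fun_space A"
  shows "S f = T f"
  using assms by (simp add: linear_op_expand[of A B])

text \<open>A linear operator with prescribed values on the basis exists; it is unique by
  \<open>linear_op_eqI\<close>.\<close>

lemma linear_op_exists:
  assumes "finite A" "\<And>p. p \<in> A \<Longrightarrow> w p \<in> fun_space B"
  shows "\<exists>T. linear_op A B T \<and> (\<forall>p\<in>A. T (hat p) = w p)"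
proof (intro exI conjI ballI)
  let ?T = "\<lambda>f. \<Sum>p\<in>A. f p *\<^sub>C w p"
  show "linear_op A B ?T"
    unfolding linear_op_def
  proof (intro conjI ballI allI)
    show "?T f \<in> fun_space B" for f
      using assms(2) by (intro fun_space_sum fun_space_cscale)
    show "?T (f + g) = ?T f + ?T g" for f g
      by (rule ext) (simp add: sum_fun_apply cscale_def algebra_simps sum.distrib)
    show "?T (c *\<^sub>C f) = c *\<^sub>C ?T f" for c f
      by (rule ext) (simp add: sum_fun_apply cscale_def sum_distrib_left mult.assoc)
  qed
  show "?T (hat p) = w p" if "p \<in> A" for p
    using that assms(1)
    by (intro ext) (simp add: sum_fun_apply cscale_def hat_def indicator_def of_bool_def
        if_distrib if_distribR cong: if_cong)
qed

lemma ip_sum_right: "ip A f (\<Sum>i\<in>I. g i) = (\<Sum>i\<in>I. ip A f (g i))"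
  unfolding ip_def sum_fun_apply sum_distrib_left by (rule sum.swap)

lemma ip_cscale_right: "ip A f (c *\<^sub>C g) = c * ip A f g"
  by (simp add: ip_def cscale_def sum_distrib_left algebra_simps)

lemma ip_add_left: "ip A (f + g) h = ip A f h + ip A g h"
  by (simp add: ip_def algebra_simps sum.distrib)

lemma ip_cscale_left: "ip A (c *\<^sub>C f) g = cnj c * ip A f g"
  by (simp add: ip_def cscale_def sum_distrib_left algebra_simps)

lemma fun_space_eqI:
  assumes "finite A" "f \<in> fun_space A" "g \<in> fun_space A"
    and "\<And>h. h \<in> fun_space A \<Longrightarrow> ip A f h = ip A g h"
  shows "f = g"
proof
  fix y
  show "f y = g y"
  proof (cases "y \<in> A")
    case True
    then have "cnj (f y) = cnj (g y)"
      using assms(4)[OF hat_in_fun_space[OF True]] assms(1) by (simp add: ip_hat_right)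
    then show ?thesis by simp
  qed (use assms(2,3) in \<open>simp add: fun_space_def\<close>)
qed

lemma adjoint_op_ex1:
  assumes "finite A" "linear_op A B T"
  shows "\<exists>!f. f \<in> fun_space A \<and> (\<forall>h\<in>fun_space A. ip A f h = ip B g (T h))"
proof (rule ex_ex1I)
  let ?f = "\<lambda>p. if p \<in> A then cnj (ip B g (T (hat p))) else 0"
  have "ip A ?f h = ip B g (T h)" if "h \<in> fun_space A" for h
    by (simp add: linear_op_expand[OF assms that] ip_sum_right ip_cscale_right)
      (simp add: ip_def mult.commute)
  then show "\<exists>f. f \<in> fun_space A \<and> (\<forall>h\<in>fun_space A. ip A f h = ip B g (T h))"
    by (intro exI[of _ ?f]) (auto simp: fun_space_def)
qed (use fun_space_eqI[OF assms(1)] in auto)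

lemma adjoint_op_in_fun_space:
  assumes "finite A" "linear_op A B T"
  shows "adjoint_op A B T g \<in> fun_space A"
  using theI'[OF adjoint_op_ex1[OF assms]] unfolding adjoint_op_def by blast

lemma adjoint_op_ip:
  assumes "finite A" "linear_op A B T" "h \<in> fun_space A"
  shows "ip A (adjoint_op A B T g) h = ip B g (T h)"
  using theI'[OF adjoint_op_ex1[OF assms(1,2)]] assms(3) unfolding adjoint_op_def by blast

lemma adjoint_op_unique:
  assumes "finite A" "linear_op A B T" "f \<in> fun_space A"
    and "\<And>h. h \<in> fun_space A \<Longrightarrow> ip A f h = ip B g (T h)"
  shows "adjoint_op A B T g = f"
  using assms by (intro fun_space_eqI) (auto simp: adjoint_op_in_fun_space adjoint_op_ip)

lemma linear_op_adjoint_op: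
  assumes "finite A" "linear_op A B T"
  shows "linear_op B A (adjoint_op A B T)"
  unfolding linear_op_def
  by (intro conjI ballI allI adjoint_op_unique[OF assms])
    (auto simp: assms adjoint_op_in_fun_space adjoint_op_ip fun_space_add fun_space_cscale
      ip_add_left ip_cscale_left)

end

theory Submission
  imports Defs
begin

text \<open>The adjoint has matrix entries \<open>(T\<^sup>* \<delta>\<^sub>q)(p) = cnj ((T \<delta>\<^sub>p)(q))\<close>. Distinct vertices of a level have
  disjoint sets of offspring, so each column of the adjoint of \<open>U n\<close> has at most one nonzero
  entry, which is (i). Then \<open>U\<^sup>* U\<close> multiplies each basis vector by the sum of the \<open>|c|\<^sup>2\<close> over its
  offspring, which is \<open>1\<close>. The formula for \<open>U U\<^sup>*\<close> is
  \<open>T T\<^sup>* = \<Sum>\<^sub>p |T \<delta>\<^sub>p\<rangle>\<langle>T \<delta>\<^sub>p|\<close>, which holds for every linear operator.\<close>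

lemma cnj_ip: "cnj (ip A f g) = ip A g f"
  by (simp add: ip_def mult.commute)

lemma linear_op_compose:
  assumes "linear_op A B S" "linear_op B C T"
  shows "linear_op A C (\<lambda>f. T (S f))"
  using assms by (simp add: linear_op_def)

lemma linear_op_ident: "linear_op A A (\<lambda>f. f)"
  by (simp add: linear_op_def fun_space_add)

text \<open>Pairing with \<open>hat p\<close> on the right reads off the conjugate of the coordinate
  at \<open>p\<close>; the adjoint identity evaluates this pairing.\<close>

lemma adjoint_op_apply:
  assumes "finite A" "linear_op A B T" "p \<in> A"
  shows "adjoint_op A B T g p = ip B (T (hat p)) g"
proof -
  have "cnj (adjoint_op A B T g p) = ip B g (T (hat p))"
    using adjoint_op_ip[OF assms(1,2) hat_in_fun_space[OF assms(3)]] assms(1,3)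
    by (simp add: ip_hat_right)
  then show ?thesis
    by (metis cnj_ip complex_cnj_cnj)
qed

text \<open>Expand \<open>adjoint_op A B T g\<close> in the basis and apply \<open>T\<close>: by
  \<open>adjoint_op_apply\<close> the coefficients are those of the ket-bra operators.\<close>

lemma op_adjoint_op_eq_sum_ketbra:
  assumes "finite A" "linear_op A B T"
  shows "T (adjoint_op A B T g) = (\<Sum>p\<in>A. ketbra B (T (hat p)) (T (hat p)) g)"
  using linear_op_expand[OF assms adjoint_op_in_fun_space[OF assms, of g]]
  by (simp add: ketbra_def adjoint_op_apply[OF assms] cong: sum.cong)

text \<open>Moving \<open>T\<close> across the inner product shows that \<open>T\<close> preserves
  norms on all of \<open>fun_space A\<close>, in particular on the orthogonal complement of its
  kernel.\<close>

lemma partial_isometry_if_left_inverse: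
  assumes "finite A" "linear_op A B T"
    and "\<And>f. f \<in> fun_space A \<Longrightarrow> adjoint_op A B T (T f) = f"
  shows "partial_isometry A B T"
proof -
  have "ip B (T f) (T f) = ip A f f" if "f \<in> fun_space A" for f
    using adjoint_op_ip[OF assms(1,2) that, of "T f"] assms(3)[OF that] by simp
  then show ?thesis
    using assms(2) by (simp add: partial_isometry_def ip_norm_def)
qed

lemma finite_level: "finite (level x n)"
  by (simp add: level_def)

lemma child_index_less:
  assumes "n \<ge> 1" "j < 4 ^ (n - 1)" "k < 4"
  shows "4 * j + k < (4::nat) ^ n"
proof -
  \<comment> \<open>Subtraction is truncated, so this identity needs \<open>n \<ge> 1\<close>; it
    fails at \<open>n = 0\<close>.\<close>
  have "(4::nat) ^ n = 4 * 4 ^ (n - 1)"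
    using assms(1) by (cases n) auto
  then show ?thesis
    using assms by linarith
qed

lemma child_in_level:
  assumes "n \<ge> 1" "j < 4 ^ (n - 1)" "k < 4"
  shows "x (n + 1) (4 * j + k) \<in> level x (n + 1)"
  using child_index_less[OF assms] by (auto simp: level_def)

lemma level_subset_vertices: "n \<ge> 1 \<Longrightarrow> level x n \<subseteq> vertices x"
  by (auto simp: vertices_def)

lemma tree_enumeration_eq_iff:
  assumes "tree_enumeration x" "n \<ge> 1" "m \<ge> 1" "j < 4 ^ (n - 1)" "i < 4 ^ (m - 1)"
  shows "x n j = x m i \<longleftrightarrow> n = m \<and> j = i"
proof
  assume eq: "x n j = x m i"
  have "x n j \<in> level x n" "x m i \<in> level x m"
    using assms(4,5) by (auto simp: level_def)
  then have "n = m"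
    using assms(1-3) eq unfolding tree_enumeration_def disjoint_family_on_def by fastforce
  with assms eq show "n = m \<and> j = i"
    unfolding tree_enumeration_def inj_on_def by blast
qed simp

text \<open>Equal vertices have equal indices, and division by 4 with remainder recovers parent and
  position from the index.\<close>

lemma child_eq_iff:
  assumes "tree_enumeration x" "n \<ge> 1"
    and "j < 4 ^ (n - 1)" "k < 4" "i < 4 ^ (n - 1)" "l < 4"
  shows "x (n + 1) (4 * j + k) = x (n + 1) (4 * i + l) \<longleftrightarrow> j = i \<and> k = l"
proof -
  have "x (n + 1) (4 * j + k) = x (n + 1) (4 * i + l) \<longleftrightarrow> 4 * j + k = 4 * i + l"
    using assms child_index_less[of n j k] child_index_less[of n i l]
    by (subst tree_enumeration_eq_iff) auto
  also have "\<dots> \<longleftrightarrow> j = i \<and> k = l"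
    using assms(4,6) by presburger
  finally show ?thesis .
qed

text \<open>The definition quantifies over all names of the parent; injectivity of the enumeration
  leaves only \<open>n\<close> and \<open>j\<close>.\<close>

lemma offspring_iff:
  assumes "tree_enumeration x" "n \<ge> 1" "j < 4 ^ (n - 1)"
  shows "offspring x (x n j) q \<longleftrightarrow> (\<exists>k<4. q = x (n + 1) (4 * j + k))"
  unfolding offspring_def using assms tree_enumeration_eq_iff[OF assms(1,2) _ assms(3)] by metis

text \<open>Turns the normalization over the infinite vertex set into a finite sum over the four
  children.\<close>

lemma sum_norm_coupling:
  assumes tree: "tree_enumeration x" and amp: "unitary_transition_amplitude x a"
    and n: "n \<ge> 1" and j: "j < 4 ^ (n - 1)"
  shows "(\<Sum>k<4. (cmod (coupling x a n j k))\<^sup>2) = 1"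
proof -
  define Y where "Y = (\<lambda>k. x (n + 1) (4 * j + k)) ` {..<4}"
  have p: "x n j \<in> vertices x"
    using n j by (auto simp: vertices_def level_def)
  have Y: "Y \<subseteq> vertices x"
    using child_in_level[OF n j] level_subset_vertices[of "n + 1" x] by (auto simp: Y_def)
  have "((\<lambda>q. (cmod (a (x n j) q))\<^sup>2) has_sum 1) (vertices x)"
    using amp p by (simp add: unitary_transition_amplitude_def)
  \<comment> \<open>The amplitude vanishes off the children \<open>Y\<close>, so restricting the sum
    to \<open>Y\<close> keeps its value.\<close>
  also have "?this \<longleftrightarrow> ((\<lambda>q. (cmod (a (x n j) q))\<^sup>2) has_sum 1) Y"
  proof (rule has_sum_cong_neutral)
    fix q
    assume "q \<in> vertices x - Y"
    then have "a (x n j) q = 0"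
      using amp p offspring_iff[OF tree n j, of q]
      by (auto simp: unitary_transition_amplitude_def Y_def)
    then show "(cmod (a (x n j) q))\<^sup>2 = 0" by simp
  qed (use Y in auto)
  finally have "(\<Sum>q\<in>Y. (cmod (a (x n j) q))\<^sup>2) = 1"
    by (metis Y_def finite_imageI finite_lessThan has_sum_finite_iff)
  \<comment> \<open>The four children are distinct, so the sum over the set \<open>Y\<close> is a
    sum over \<open>k\<close> without collapsed terms.\<close>
  moreover have "inj_on (\<lambda>k. x (n + 1) (4 * j + k)) {..<4}"
    using child_eq_iff[OF tree n j _ j] by (auto simp: inj_on_def)
  ultimately show ?thesis
    by (simp add: Y_def sum.reindex coupling_def)
qed

theorem theorem3p1:
  fixes x :: "nat \<Rightarrow> nat \<Rightarrow> 'a"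
    and a :: "'a \<Rightarrow> 'a \<Rightarrow> complex"
    and c :: "nat \<Rightarrow> nat \<Rightarrow> nat \<Rightarrow> complex"
    and U :: "nat \<Rightarrow> ('a \<Rightarrow> complex) \<Rightarrow> ('a \<Rightarrow> complex)"
  assumes "tree_enumeration x"
    and "unitary_transition_amplitude x a"
    and "c = coupling x a"
    and "\<And>n. n \<ge> 1 \<Longrightarrow> linear_op (level x n) (level x (n + 1)) (U n)"
    and "\<And>n j. n \<ge> 1 \<Longrightarrow> j < 4 ^ (n - 1) \<Longrightarrow>
           U n (hat (x n j)) = (\<Sum>k<4. c n j k *\<^sub>C hat (x (n + 1) (4 * j + k)))"
  shows "\<forall>n\<ge>1.
      (\<forall>j<4 ^ (n - 1). \<forall>k<4.
         adjoint_op (level x n) (level x (n + 1)) (U n) (hat (x (n + 1) (4 * j + k)))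
           = cnj (c n j k) *\<^sub>C hat (x n j)) \<and>
      partial_isometry (level x n) (level x (n + 1)) (U n) \<and>
      (\<forall>f\<in>fun_space (level x n).
         adjoint_op (level x n) (level x (n + 1)) (U n) (U n f) = f) \<and>
      (\<forall>g\<in>fun_space (level x (n + 1)).
         U n (adjoint_op (level x n) (level x (n + 1)) (U n) g)
           = (\<Sum>j<4 ^ (n - 1).
                ketbra (level x (n + 1))
                  (\<Sum>k<4. c n j k *\<^sub>C hat (x (n + 1) (4 * j + k)))
                  (\<Sum>k<4. c n j k *\<^sub>C hat (x (n + 1) (4 * j + k)))) g)"
proof (intro allI impI)
  fix n :: nat
  assume n: "n \<ge> 1"
  let ?A = "level x n" and ?B = "level x (n + 1)"
  let ?adj = "adjoint_op ?A ?B (U n)"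
  note tree = assms(1) and Un = assms(5)[OF n]
  have lin: "linear_op ?A ?B (U n)"
    using assms(4) n .
  note adj_lin = linear_op_adjoint_op[OF finite_level lin]
  \<comment> \<open>The matrix of \<open>U n\<close>: a child of \<open>x n j\<close> occurs in the
    image of \<open>hat (x n i)\<close> only if \<open>i = j\<close>, and then only in the term
    \<open>l = k\<close>.\<close>
  have entry: "U n (hat (x n i)) (x (n + 1) (4 * j + k)) = (if i = j then c n j k else 0)"
    if "i < 4 ^ (n - 1)" "j < 4 ^ (n - 1)" "k < 4" for i j k
  proof -
    have "U n (hat (x n i)) (x (n + 1) (4 * j + k))
        = (\<Sum>l<4. if l = k then (if i = j then c n j k else 0) else 0)"
      unfolding Un[OF that(1)] sum_fun_apply
      using child_eq_iff[OF tree n that(2,3,1)]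
      by (intro sum.cong) (auto simp: cscale_def hat_def)
    then show ?thesis using that(3) by simp
  qed
  have adj: "?adj (hat (x (n + 1) (4 * j + k))) = cnj (c n j k) *\<^sub>C hat (x n j)"
    if j: "j < 4 ^ (n - 1)" and k: "k < 4" for j k
  proof
    fix p
    show "?adj (hat (x (n + 1) (4 * j + k))) p = (cnj (c n j k) *\<^sub>C hat (x n j)) p"
    proof (cases "p \<in> ?A")
      case True
      then obtain i where i: "i < 4 ^ (n - 1)" "p = x n i"
        by (auto simp: level_def)
      have "?adj (hat (x (n + 1) (4 * j + k))) p
          = cnj (U n (hat (x n i)) (x (n + 1) (4 * j + k)))"
        unfolding adjoint_op_apply[OF finite_level lin True] unfolding i(2)
        by (rule ip_hat_right[OF finite_level child_in_level[OF n j k]])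
      then show ?thesis
        using entry[OF i(1) j k] tree_enumeration_eq_iff[OF tree n n i(1) j] i(2)
        by (simp add: cscale_def hat_def)
    next
      \<comment> \<open>Off the level both sides are zero, since functions are extended by
        zero.\<close>
      case False
      moreover from False j have "p \<noteq> x n j" by (auto simp: level_def)
      ultimately show ?thesis
        using adjoint_op_in_fun_space[OF finite_level lin]
        by (simp add: fun_space_def cscale_def hat_def)
    qed
  qed
  have "?adj (U n (hat p)) = hat p" if p: "p \<in> ?A" for p
  proof -
    obtain j where j: "j < 4 ^ (n - 1)" "p = x n j"
      using p by (auto simp: level_def)
    note child = hat_in_fun_space[OF child_in_level[OF n j(1), where x = x]]
    have "?adj (U n (hat p)) = (\<Sum>k<4. ?adj (c n j k *\<^sub>C hat (x (n + 1) (4 * j + k))))"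
      unfolding j(2) Un[OF j(1)]
      by (rule linear_op_sum[OF adj_lin]) (use child fun_space_cscale in auto)
    also have "\<dots> = (\<Sum>k<4. c n j k *\<^sub>C cnj (c n j k) *\<^sub>C hat p)"
      using adj_lin child adj[OF j(1)] j(2) by (intro sum.cong) (auto simp: linear_op_def)
    also have "\<dots> = complex_of_real (\<Sum>k<4. (cmod (c n j k))\<^sup>2) *\<^sub>C hat p"
      unfolding of_real_sum complex_norm_square
      by (rule ext) (simp add: sum_fun_apply cscale_def sum_distrib_right mult.assoc)
    also have "\<dots> = hat p"
      using sum_norm_coupling[OF tree assms(2) n j(1)] assms(3) by (simp add: cscale_def)
    finally show ?thesis .
  qed
  \<comment> \<open>Both sides are linear in \<open>f\<close>, so agreement on the basis
    suffices.\<close>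
  then have left_inverse: "?adj (U n f) = f" if "f \<in> fun_space ?A" for f
    using linear_op_eqI[OF finite_level linear_op_compose[OF lin adj_lin] linear_op_ident _ that]
    by blast
  \<comment> \<open>Needed to reindex the ket-bra sum from vertices of the level to indices
    \<open>j\<close>.\<close>
  have "inj_on (x n) {..<4 ^ (n - 1)}"
    using tree n by (simp add: tree_enumeration_def)
  then have "U n (?adj g) = (\<Sum>j<4 ^ (n - 1).
      ketbra ?B (\<Sum>k<4. c n j k *\<^sub>C hat (x (n + 1) (4 * j + k)))
        (\<Sum>k<4. c n j k *\<^sub>C hat (x (n + 1) (4 * j + k))) g)" for g
    unfolding op_adjoint_op_eq_sum_ketbra[OF finite_level lin]
    by (subst (1) level_def) (simp add: sum.reindex Un)
  then show "(\<forall>j<4 ^ (n - 1). \<forall>k<4.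
        ?adj (hat (x (n + 1) (4 * j + k))) = cnj (c n j k) *\<^sub>C hat (x n j)) \<and>
      partial_isometry ?A ?B (U n) \<and>
      (\<forall>f\<in>fun_space ?A. ?adj (U n f) = f) \<and>
      (\<forall>g\<in>fun_space ?B. U n (?adj g) = (\<Sum>j<4 ^ (n - 1).
        ketbra ?B (\<Sum>k<4. c n j k *\<^sub>C hat (x (n + 1) (4 * j + k)))
          (\<Sum>k<4. c n j k *\<^sub>C hat (x (n + 1) (4 * j + k)))) g)"
    using adj left_inverse partial_isometry_if_left_inverse[OF finite_level lin left_inverse]
    by (simp add: sum_fun_apply)
qed

end
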